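(* Consider Algorithm IPALM (described in the context) with $\beta_s\ge\beta_{s+1}>\beta_s/2$, and an inner solver $\mathcal A$ satisfying the linear convergence requirement described in the context. Let $m_{s+1}>0$ be an integer satisfying $$2\epsilon_s+\beta_s\|\lambda^{s+1}-\lambda^s\|^2+\frac{\beta_s-\beta_{s+1}}2\|\Lambda(p(x^s);\lambda^{s+1},\beta_{s+1})-\lambda^{s+1}\|^2+\frac{\beta_s^2}{2\beta_{s+1}-\beta_s}\|x^{s-1}-x^s\|^2$$ $$+\|\lambda^{s+1}-\lambda^s\|\sqrt{\left((\beta_s+\beta_{s+1})L_{h_1}+\|\beta_s\lambda_1^s-\beta_{s+1}\lambda_1^{s+1}\|\right)^2+\|\beta_s\lambda_2^s-\beta_{s+1}\lambda_2^{s+1}\|^2}\ \le\ 2^{\lfloor m_{s+1}/K_{s+1}\rfloor}\,\epsilon_{s+1}/2 .$$ If $\mathbb E[H_s(x^s)-H_s^\star]\le\epsilon_s$, then $\mathbb E[H_{s+1}(x^{s+1})-H_{s+1}^\star]\le\epsilon_{s+1}$ is guaranteed by letting $$x^{s+1}=\mathcal A(x^s,m_{s+1},H_{s+1}).$$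
   Context: Setting. Let $d=d_1+d_2$; for $\lambda\in\mathbb R^d$ write $\lambda=(\lambda_1;\lambda_2)$ with $\lambda_i\in\mathbb R^{d_i}$. $\|\cdot\|$ is the Euclidean norm. $g:\mathbb R^n\to\mathbb R\cup\{+\infty\}$ and $h_1:\mathbb R^{d_1}\to\mathbb R$ are proper, convex, closed; $h_2$ is the indicator function of a nonempty closed convex set $\mathcal K\subset\mathbb R^{d_2}$; $f:\mathbb R^n\to\mathbb R\cup\{+\infty\}$ is convex and differentiable on an open set containing $\operatorname{dom}(g)$; $p_1:\mathbb R^n\to\mathbb R^{d_1}$, $p_2:\mathbb R^n\to\mathbb R^{d_2}$ are differentiable. Put $p(x)=(p_1(x);p_2(x))$, $h(u)=h_1(u_1)+h_2(u_2)$, $h^*$ the Fenchel conjugate, $F(x)=f(x)+g(x)+h_1(p_1(x))$. The primal problem is $\min_x f(x)+g(x)+h(p(x))$; the Lagrangian is $L(x;\lambda)=f(x)+g(x)+\langle\lambda,p(x)\rangle-h^*(\lambda)$, and the dual problem is $\max_\lambda D(\lambda)$, $D(\lambda)=\inf_xL(x;\lambda)$. Standing assumptions: (a) $h_1$ is $L_{h_1}$-Lipschitz. (b) For all $x,y\in\mathbb R^n$, $u_1,v_1\in\mathbb R^{d_1}$, $\alpha\in(0,1)$: $h_1(p_1(\alpha x+(1-\alpha)y)-\alpha u_1-(1-\alpha)v_1)\le\alpha h_1(p_1(x)-u_1)+(1-\alpha)h_1(p_1(y)-v_1)$. (c) For all $x,y\in\mathbb R^n$, $u_2,v_2\in\mathbb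 R^{d_2}$, $\alpha\in(0,1)$ with $p_2(x)-u_2\in\mathcal K$, $p_2(y)-v_2\in\mathcal K$: $p_2(\alpha x+(1-\alpha)y)-\alpha u_2-(1-\alpha)v_2\in\mathcal K$. (d) Primal and dual have optimal solutions and strong duality holds: there are $x^\star\in\operatorname{dom}(g)$, $\lambda^\star\in\operatorname{dom}(h^* )$ with $p_2(x^\star)\in\mathcal K$ and $F(x^\star)=L(x^\star;\lambda^\star)=D(\lambda^\star)$. Smoothing. For $u,\lambda\in\mathbb R^d$, $\beta>0$: $h(u;\lambda,\beta)=\max_v\{\langle v,u\rangle-h^*(v)-\frac\beta2\|v-\lambda\|^2\}$, $\Lambda(u;\lambda,\beta)$ is its unique maximizer, and $L(x;y,\lambda,\beta)=f(x)+g(x)+h(p(x);\lambda,\beta)+\frac\beta2\|x-y\|^2$. Algorithm IPALM. Given positive sequences $\{\epsilon_s\},\{\beta_s\}$ and deterministic $x^{-1}\in\operatorname{dom}(g)$, $\lambda^0\in\operatorname{dom}(h^* )$; for $s=0,1,\dots$, with $H_s(x)=L(x;x^{s-1},\lambda^s,\beta_s)$ and $H_s^\star=\min_xH_s(x)$, find a (possibly random) $x^s$ with $\mathbb E[H_s(x^s)-H_s^\star]\le\epsilon_s$, and set $\lambda^{s+1}=\Lambda(p(x^s);\lambda^s,\beta_s)$. $\mathcal F_s$ denotes the $\sigma$-algebra generated by $\{x^t,\lambda^t:t\le s\}$. Inner solver. $\mathcal A(x,k,H_s)$ denotes the (possibly random) output of $k$ iterations of algorithm $\mathcal A$ on $\min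 H_s$ started at $x$. Linear convergence requirement: for every $s\ge0$ there is a $K_s\ge1$ such that for every $x\in\operatorname{dom}(g)$ and every number of iterations $k$ (both possibly $\mathcal F_{s-1}$-measurable), $\mathbb E[H_s(\mathcal A(x,k,H_s))-H_s^\star\mid\mathcal F_{s-1}]\le2^{-\lfloor k/K_s\rfloor}(H_s(x)-H_s^\star)$. *)

theory Defs
  imports "HOL-Probability.Probability"
begin

definition edom :: "('a \<Rightarrow> ereal) \<Rightarrow> 'a set" where
  "edom \<phi> = {x. \<phi> x < \<infinity>}"

definition epi :: "('a \<Rightarrow> ereal) \<Rightarrow> ('a \<times> real) set" where
  "epi \<phi> = {(x, r). \<phi> x \<le> ereal r}"

definition proper_fun :: "('a \<Rightarrow> ereal) \<Rightarrow> bool" where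
  "proper_fun \<phi> \<longleftrightarrow> (\<forall>x. \<phi> x \<noteq> -\<infinity>) \<and> edom \<phi> \<noteq> {}"

definition convex_fun :: "('a::real_vector \<Rightarrow> ereal) \<Rightarrow> bool" where
  "convex_fun \<phi> \<longleftrightarrow> convex (epi \<phi>)"

definition closed_fun :: "('a::topological_space \<Rightarrow> ereal) \<Rightarrow> bool" where
  "closed_fun \<phi> \<longleftrightarrow> closed (epi \<phi>)"

definition set_indicator :: "'a set \<Rightarrow> 'a \<Rightarrow> ereal" where
  "set_indicator C u = (if u \<in> C then 0 else \<infinity>)"

definition conjugate :: "('a::real_inner \<Rightarrow> ereal) \<Rightarrow> 'a \<Rightarrow> ereal" where
  "conjugate \<phi> v = (SUP u. ereal (inner v u) - \<phi> u)"

text \<open>The convention is that such a function is real-valued on the open set in question;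
  outside it the value may be infinite.\<close>

definition differentiable_near :: "('a::real_normed_vector \<Rightarrow> ereal) \<Rightarrow> 'a set \<Rightarrow> bool" where
  "differentiable_near f S \<longleftrightarrow>
     (\<exists>U. open U \<and> S \<subseteq> U \<and> (\<forall>x\<in>U. \<bar>f x\<bar> \<noteq> \<infinity>) \<and>
          (\<forall>x\<in>U. (\<lambda>y. real_of_ereal (f y)) differentiable (at x)))"

text \<open>The space of dimension \<open>d\<^sub>1 + d\<^sub>2\<close> is the product type, whose norm and inner product are
  the Euclidean ones; the two blocks of a vector are its \<open>fst\<close> and \<open>snd\<close>.\<close>

definition sep_sum :: "('b \<Rightarrow> real) \<Rightarrow> 'c set \<Rightarrow> 'b \<times> 'c \<Rightarrow> ereal" where
  "sep_sum h1 C u = ereal (h1 (fst u)) + set_indicator C (snd u)"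

definition primal_obj ::
  "('a \<Rightarrow> ereal) \<Rightarrow> ('a \<Rightarrow> ereal) \<Rightarrow> ('d \<Rightarrow> ereal) \<Rightarrow> ('a \<Rightarrow> 'd) \<Rightarrow> 'a \<Rightarrow> ereal" where
  "primal_obj f g h p x = f x + g x + h (p x)"

definition lagrangian ::
  "('a \<Rightarrow> ereal) \<Rightarrow> ('a \<Rightarrow> ereal) \<Rightarrow> ('d::real_inner \<Rightarrow> ereal) \<Rightarrow> ('a \<Rightarrow> 'd) \<Rightarrow> 'a \<Rightarrow> 'd \<Rightarrow> ereal" where
  "lagrangian f g h p x l = f x + g x + ereal (inner l (p x)) - conjugate h l"

definition dual_fun ::
  "('a \<Rightarrow> ereal) \<Rightarrow> ('a \<Rightarrow> ereal) \<Rightarrow> ('d::real_inner \<Rightarrow> ereal) \<Rightarrow> ('a \<Rightarrow> 'd) \<Rightarrow> 'd \<Rightarrow> ereal" where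
  "dual_fun f g h p l = (INF x. lagrangian f g h p x l)"

definition smooth_obj :: "('d::real_inner \<Rightarrow> ereal) \<Rightarrow> 'd \<Rightarrow> 'd \<Rightarrow> real \<Rightarrow> 'd \<Rightarrow> ereal" where
  "smooth_obj h u l b v =
     ereal (inner v u) - conjugate h v - ereal (b / 2 * (norm (v - l))\<^sup>2)"

definition smoothed :: "('d::real_inner \<Rightarrow> ereal) \<Rightarrow> 'd \<Rightarrow> 'd \<Rightarrow> real \<Rightarrow> ereal" where
  "smoothed h u l b = (SUP v. smooth_obj h u l b v)"

definition smooth_argmax :: "('d::real_inner \<Rightarrow> ereal) \<Rightarrow> 'd \<Rightarrow> 'd \<Rightarrow> real \<Rightarrow> 'd" where
  "smooth_argmax h u l b = (THE v. is_arg_max (smooth_obj h u l b) (\<lambda>_. True) v)"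

definition prox_lagrangian ::
  "('a::real_normed_vector \<Rightarrow> ereal) \<Rightarrow> ('a \<Rightarrow> ereal) \<Rightarrow> ('d::real_inner \<Rightarrow> ereal) \<Rightarrow> ('a \<Rightarrow> 'd) \<Rightarrow>
   'a \<Rightarrow> 'a \<Rightarrow> 'd \<Rightarrow> real \<Rightarrow> ereal" where
  "prox_lagrangian f g h p x y l b =
     f x + g x + smoothed h (p x) l b + ereal (b / 2 * (norm (x - y))\<^sup>2)"

text \<open>The iterates \<open>x\<^sup>0, x\<^sup>1, \<dots>\<close> are \<open>x 0, x 1, \<dots>\<close>; the deterministic starting point with index
  \<open>-1\<close> is kept separately.\<close>

definition prev_iterate :: "'a \<Rightarrow> (nat \<Rightarrow> 'w \<Rightarrow> 'a) \<Rightarrow> nat \<Rightarrow> 'w \<Rightarrow> 'a" where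
  "prev_iterate xinit x s \<omega> = (case s of 0 \<Rightarrow> xinit | Suc t \<Rightarrow> x t \<omega>)"

definition stage_obj ::
  "('a::real_normed_vector \<Rightarrow> ereal) \<Rightarrow> ('a \<Rightarrow> ereal) \<Rightarrow> ('d::real_inner \<Rightarrow> ereal) \<Rightarrow> ('a \<Rightarrow> 'd) \<Rightarrow>
   (nat \<Rightarrow> real) \<Rightarrow> 'a \<Rightarrow> (nat \<Rightarrow> 'w \<Rightarrow> 'a) \<Rightarrow> (nat \<Rightarrow> 'w \<Rightarrow> 'd) \<Rightarrow> nat \<Rightarrow> 'w \<Rightarrow> 'a \<Rightarrow> ereal" where
  "stage_obj f g h p \<beta> xinit x lam s \<omega> z =
     prox_lagrangian f g h p z (prev_iterate xinit x s \<omega>) (lam s \<omega>) (\<beta> s)"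

text \<open>The optimality gap is nonnegative, so its expectation is taken as a nonnegative
  (possibly infinite) Lebesgue integral; no integrability side condition is then needed.\<close>

definition opt_gap :: "('a \<Rightarrow> ereal) \<Rightarrow> 'a \<Rightarrow> ennreal" where
  "opt_gap H z = e2ennreal (H z - (INF w. H w))"

text \<open>The sigma-algebra generated by the iterates and multipliers with index strictly below
  \<open>s\<close>, usually written with index \<open>s - 1\<close>. For \<open>s = 0\<close> it is trivial, in accordance with the
  starting point being deterministic.\<close>

definition history ::
  "'w measure \<Rightarrow> (nat \<Rightarrow> 'w \<Rightarrow> 'a::topological_space) \<Rightarrow> (nat \<Rightarrow> 'w \<Rightarrow> 'd::topological_space) \<Rightarrow>
   nat \<Rightarrow> 'w measure" where
  "history M x lam s = sigma (space M)
     (\<Union>t<s. {x t -` B \<inter> space M | B. B \<in> sets borel} \<union>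
            {lam t -` B \<inter> space M | B. B \<in> sets borel})"

text \<open>\<open>\<A> r z k H\<close> is the output of \<open>k\<close> iterations of the solver on \<open>H\<close> started at \<open>z\<close> with random
  seed \<open>r\<close>; a deterministic solver ignores \<open>r\<close>. The seed \<open>\<xi>\<close> used in a call is a function of the
  outcome; no independence is assumed, the bound being conditional on the past \<open>F\<close>.
  Measurability of the output is required because \<^const>\<open>nn_cond_exp\<close> is \<open>0\<close> by convention on
  non-measurable functions.\<close>

definition lin_convergent ::
  "'w measure \<Rightarrow> 'w measure \<Rightarrow> 'a::euclidean_space set \<Rightarrow> ('w \<Rightarrow> 'a \<Rightarrow> ereal) \<Rightarrow>
   ('r \<Rightarrow> 'a \<Rightarrow> nat \<Rightarrow> ('a \<Rightarrow> ereal) \<Rightarrow> 'a) \<Rightarrow> ('w \<Rightarrow> 'r) \<Rightarrow> real \<Rightarrow> bool" where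
  "lin_convergent M F S H \<A> \<xi> \<kappa> \<longleftrightarrow>
     (\<forall>z k. z \<in> F \<rightarrow>\<^sub>M borel \<and> (\<forall>\<omega>\<in>space M. z \<omega> \<in> S) \<and> k \<in> F \<rightarrow>\<^sub>M count_space UNIV \<longrightarrow>
        (\<lambda>\<omega>. \<A> (\<xi> \<omega>) (z \<omega>) (k \<omega>) (H \<omega>)) \<in> M \<rightarrow>\<^sub>M borel \<and>
        (AE \<omega> in M.
           nn_cond_exp M F (\<lambda>\<omega>. opt_gap (H \<omega>) (\<A> (\<xi> \<omega>) (z \<omega>) (k \<omega>) (H \<omega>))) \<omega>
             \<le> ennreal (2 powi (- \<lfloor>real (k \<omega>) / \<kappa>\<rfloor>)) * opt_gap (H \<omega>) (z \<omega>)))"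

end

theory Submission
  imports Defs
begin

text \<open>Write \<open>q\<close> for the contraction factor of the solver, \<open>x\<close>, \<open>y\<close>, \<open>\<lambda>\<close>, \<open>\<beta>\<close> for the iterate, the
  proximal centre, the multiplier and the parameter of stage \<open>s\<close>, and \<open>\<lambda>'\<close>, \<open>\<beta>'\<close> for those of stage
  \<open>s + 1\<close>, whose centre is \<open>x\<close>. The heart of the matter is a pathwise comparison of the optimality
  gaps of the same point \<open>x\<close> for two consecutive objectives (\<open>opt_gap_next_stage_le\<close>): the gap at
  stage \<open>s + 1\<close> is at most twice the gap at stage \<open>s\<close> plus a drift \<open>D\<close>, made of multiples of
  \<open>|\<lambda>' - \<lambda>|\<^sup>2\<close>, \<open>|\<Lambda>(p(x); \<lambda>', \<beta>') - \<lambda>'|\<^sup>2\<close> and \<open>|y - x|\<^sup>2\<close>.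

  Two convexity arguments give it. The value at \<open>x\<close> grows little, since the function maximised in
  the definition of \<open>h(u; \<lambda>, \<beta>)\<close> is strongly concave with maximiser \<open>\<lambda>'\<close>
  (\<open>smoothed_update_le\<close>). The infimum drops little, for the following reason. Moreau duality
  (\<open>moreau_duality\<close>) rewrites the smoothed function as the minimum over \<open>t \<in> dom h\<close> of
  \<open>h(t) + \<langle>\<lambda>, u - t\<rangle> + |u - t|\<^sup>2/(2\<beta>)\<close>, with \<open>\<lambda>' = \<lambda> + (u - t)/\<beta>\<close> at the minimiser. So the stage
  objective is a partial minimum of a function that is jointly strongly convex in the point and
  the residual \<open>p(x) - t\<close>. Evaluating that function at the midpoint between \<open>x\<close> and a competitor
  \<open>z\<close> of the next stage bounds the infimum of stage \<open>s\<close> from above; the two quadratic gains from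
  strong convexity absorb the change of the multiplier, which is a multiple of the residual at
  \<open>x\<close>, and the move of the proximal centre from \<open>y\<close> to \<open>x\<close> (\<open>next_stage_lower_bound\<close>).

  The prescribed number of iterations makes \<open>q (2 \<epsilon> s + D) \<le> \<epsilon> (Suc s) / 2\<close>. Both summands are
  nonnegative, so \<open>q \<le> \<epsilon> (Suc s) / (4 \<epsilon> s)\<close> and \<open>q D \<le> \<epsilon> (Suc s) / 2\<close> hold pointwise: after the
  contraction, twice the old gap and the drift contribute at most \<open>\<epsilon> (Suc s) / 2\<close> each to the
  expectation (\<open>discounted_nn_integral_le\<close>). The factor \<open>q\<close> may be random because it is bounded by
  a constant before the expectation of the gap is taken.

  What remains is measurability, on which the conditional expectation depends: the multipliers
  are continuous functions of measurable data, the smoothed function is a supremum and the optimal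
  value of a stage an infimum of continuous functions, hence semicontinuous.\<close>

section \<open>Moreau duality for the smoothed function\<close>

text \<open>A finite Lipschitz convex function restricted to a closed convex set. The sum of a Lipschitz
  function of one block and the indicator of a closed convex set in the other is of this form.\<close>

locale lipschitz_restriction =
  fixes \<phi> :: "'d::euclidean_space \<Rightarrow> real" and C :: "'d set" and L :: real
    and h :: "'d \<Rightarrow> ereal"
  assumes nonempty: "C \<noteq> {}" and closed: "closed C"
    and convex: "convex_on C \<phi>" and lipschitz: "L-lipschitz_on C \<phi>"
    and h_eq: "\<And>u. h u = (if u \<in> C then ereal (\<phi> u) else \<infinity>)"
begin

text \<open>The primal form of the smoothing at \<open>u\<close>: an augmented Lagrangian in the residual \<open>u - t\<close>.
  Its minimum over \<open>C\<close> is the Moreau envelope of \<open>h\<close> at the shifted point \<open>u + b *\<^sub>R l\<close>, up to a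
  constant.\<close>

definition envelope_obj :: "'d \<Rightarrow> 'd \<Rightarrow> real \<Rightarrow> 'd \<Rightarrow> real" where
  "envelope_obj u l b t = \<phi> t + inner l (u - t) + (norm (u - t))\<^sup>2 / (2 * b)"

lemma envelope_obj_centred:
  assumes "0 < b"
  shows "envelope_obj u l b t = \<phi> t + (norm (t - (u + b *\<^sub>R l)))\<^sup>2 / (2 * b) - b / 2 * (norm l)\<^sup>2"
  using assms unfolding envelope_obj_def power2_norm_eq_inner
  by (simp add: inner_diff inner_add inner_commute algebra_simps) (simp add: field_simps)

text \<open>The Lipschitz bound makes the objective coercive: far from a reference point the quadratic
  beats any linear decrease of \<open>\<phi>\<close>, which reduces the problem to a compact set.\<close>

lemma envelope_minimiser_exists:
  assumes b: "0 < b"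
  shows "\<exists>t\<in>C. \<forall>y\<in>C. envelope_obj u l b t \<le> envelope_obj u l b y"
proof -
  define a where "a = u + b *\<^sub>R l"
  define G where "G = (\<lambda>t. \<phi> t + (norm (t - a))\<^sup>2 / (2 * b))"
  obtain t0 where t0: "t0 \<in> C" using nonempty by auto
  \<comment> \<open>beyond this radius the growth of the quadratic outweighs the decrease of \<open>\<phi>\<close>\<close>
  define R where "R = 2 * norm (t0 - a) + 2 * b * L"
  have L0: "0 \<le> L" using lipschitz lipschitz_on_nonneg by blast
  have cG: "continuous_on C G" unfolding G_def
    using b by (intro continuous_intros lipschitz_on_continuous_on[OF lipschitz]) auto
  have "compact (C \<inter> cball t0 R)" using closed compact_Int_closed[of "cball t0 R" C]
    by (simp add: Int_commute)
  moreover have "t0 \<in> C \<inter> cball t0 R" using t0 b L0 by (simp add: R_def)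
  ultimately obtain t where t: "t \<in> C \<inter> cball t0 R"
      and tmin: "\<And>y. y \<in> C \<inter> cball t0 R \<Longrightarrow> G t \<le> G y"
    using continuous_attains_inf[of "C \<inter> cball t0 R" G] cG
    by (metis continuous_on_subset empty_iff inf_le1)
  have far: "G t0 \<le> G y" if y: "y \<in> C" "y \<notin> cball t0 R" for y
  proof -
    define r where "r = norm (y - t0)"
    have r: "R < r" using y by (simp add: r_def dist_norm norm_minus_commute)
    have r0: "0 \<le> r" by (simp add: r_def)
    have tri: "r - norm (t0 - a) \<le> norm (y - a)"
      unfolding r_def using norm_triangle_ineq4[of "y - a" "t0 - a"] by simp
    have d0: "norm (t0 - a) \<le> r" using r b L0 unfolding R_def
      by (smt (verit) mult_nonneg_nonneg norm_ge_zero)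
    have "(r - norm (t0 - a))\<^sup>2 \<le> (norm (y - a))\<^sup>2"
      by (rule power_mono) (use tri d0 in auto)
    moreover have "2 * b * L * r \<le> (r - 2 * norm (t0 - a)) * r"
      by (rule mult_right_mono) (use r r0 in \<open>auto simp: R_def\<close>)
    ultimately have "(norm (t0 - a))\<^sup>2 + 2 * b * L * r \<le> (norm (y - a))\<^sup>2"
      by (simp add: power2_eq_square algebra_simps)
    hence "((norm (t0 - a))\<^sup>2 + 2 * b * L * r) / (2 * b) \<le> (norm (y - a))\<^sup>2 / (2 * b)"
      using b by (intro divide_right_mono) auto
    hence "(norm (t0 - a))\<^sup>2 / (2 * b) + L * r \<le> (norm (y - a))\<^sup>2 / (2 * b)"
      using b by (simp add: add_divide_distrib)
    moreover have "\<bar>\<phi> y - \<phi> t0\<bar> \<le> L * r"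
      using lipschitz_onD[OF lipschitz y(1) t0] by (simp add: dist_real_def dist_norm r_def)
    ultimately show ?thesis unfolding G_def by linarith
  qed
  have "G t \<le> G y" if "y \<in> C" for y
    using far[OF that] tmin[of y] tmin[OF \<open>t0 \<in> C \<inter> cball t0 R\<close>] that by (meson IntI order_trans)
  hence "envelope_obj u l b t \<le> envelope_obj u l b y" if "y \<in> C" for y
    using that unfolding envelope_obj_centred[OF b] G_def a_def by simp
  thus ?thesis using t by blast
qed

text \<open>The first-order optimality condition at \<open>t\<close>: the updated multiplier is a subgradient there.
  It follows by moving from \<open>t\<close> a small fraction \<open>\<alpha>\<close> of the way to \<open>y\<close> and dividing by \<open>\<alpha>\<close>.\<close>

lemma envelope_minimiser_subgradient:
  assumes b: "0 < b" and t: "t \<in> C"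
    and tmin: "\<And>y. y \<in> C \<Longrightarrow> envelope_obj u l b t \<le> envelope_obj u l b y"
    and y: "y \<in> C"
  shows "\<phi> t + inner (l + (1 / b) *\<^sub>R (u - t)) (y - t) \<le> \<phi> y"
proof -
  define a where "a = u + b *\<^sub>R l"
  define D where "D = \<phi> y - \<phi> t + inner (t - a) (y - t) / b"
  define E where "E = (norm (y - t))\<^sup>2 / (2 * b)"
  have key: "0 \<le> D + \<alpha> * E" if \<alpha>: "0 < \<alpha>" "\<alpha> < 1" for \<alpha>
  proof -
    define z where "z = (1 - \<alpha>) *\<^sub>R t + \<alpha> *\<^sub>R y"
    have zC: "z \<in> C" using convex \<alpha> t y unfolding z_def convex_on_def
      by (simp add: convex_alt)
    have "\<phi> z \<le> (1 - \<alpha>) * \<phi> t + \<alpha> * \<phi> y"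
      using convex \<alpha> t y unfolding z_def convex_on_def by simp
    moreover have "z - a = (t - a) + \<alpha> *\<^sub>R (y - t)" by (simp add: z_def algebra_simps)
    from arg_cong[OF this, of "\<lambda>v. (norm v)\<^sup>2"]
    have "(norm (z - a))\<^sup>2 = (norm (t - a))\<^sup>2 + 2 * \<alpha> * inner (t - a) (y - t) + \<alpha>\<^sup>2 * (norm (y - t))\<^sup>2"
      unfolding power2_norm_eq_inner
      by (simp only: inner_add_left inner_add_right inner_scaleR_left inner_scaleR_right
          inner_commute[of "y - t" "t - a"] power2_eq_square) (simp add: algebra_simps)
    hence "(norm (z - a))\<^sup>2 / (2 * b) = (norm (t - a))\<^sup>2 / (2 * b) + \<alpha> * (inner (t - a) (y - t) / b) + \<alpha> * \<alpha> * E"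
      using b by (simp add: E_def field_simps power2_eq_square)
    ultimately have "0 \<le> \<alpha> * (D + \<alpha> * E)"
      using tmin[OF zC] unfolding envelope_obj_centred[OF b] a_def[symmetric] D_def
      by (simp add: algebra_simps)
    thus ?thesis using \<alpha> by (simp add: zero_le_mult_iff)
  qed
  have "((\<lambda>\<alpha>. D + \<alpha> * E) \<longlongrightarrow> D + 0 * E) (at_right 0)"
    by (intro tendsto_intros)
  moreover have "\<forall>\<^sub>F \<alpha> in at_right (0::real). 0 \<le> D + \<alpha> * E"
    unfolding eventually_at_right_field using key zero_less_one by blast
  ultimately have "0 \<le> D + 0 * E"
    by (intro tendsto_lowerbound) auto
  hence "0 \<le> D" by simp
  moreover have "l + (1 / b) *\<^sub>R (u - t) = (- 1 / b) *\<^sub>R (t - a)"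
    using b by (simp add: a_def algebra_simps)
  ultimately show ?thesis unfolding D_def by simp
qed

text \<open>The Fenchel-Young inequality at \<open>t\<close>, with a completed square. Because the square is kept,
  this one bound yields weak duality, uniqueness of the maximiser and strong concavity around it.\<close>

lemma smooth_obj_le_envelope:
  assumes b: "0 < b" and t: "t \<in> C"
  shows "smooth_obj h u l b v
    \<le> ereal (envelope_obj u l b t - b / 2 * (norm (v - (l + (1 / b) *\<^sub>R (u - t))))\<^sup>2)"
proof -
  have fy: "ereal (inner v t - \<phi> t) \<le> conjugate h v"
    unfolding conjugate_def using t by (intro SUP_upper2[of t]) (auto simp: h_eq)
  have id: "inner v u - (inner v t - \<phi> t) - b / 2 * (norm (v - l))\<^sup>2
      = envelope_obj u l b t - b / 2 * (norm (v - (l + (1 / b) *\<^sub>R (u - t))))\<^sup>2"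
    using b unfolding envelope_obj_def power2_norm_eq_inner
    by (simp add: inner_diff inner_add inner_commute algebra_simps) (simp add: field_simps)
  show ?thesis unfolding smooth_obj_def id[symmetric]
    using fy by (cases "conjugate h v") auto
qed

text \<open>There is no duality gap: a subgradient turns Fenchel-Young into an equality, and the completed
  square vanishes.\<close>

lemma smooth_obj_eq_envelope:
  assumes b: "0 < b" and t: "t \<in> C"
    and tmin: "\<And>y. y \<in> C \<Longrightarrow> envelope_obj u l b t \<le> envelope_obj u l b y"
  shows "smooth_obj h u l b (l + (1 / b) *\<^sub>R (u - t)) = ereal (envelope_obj u l b t)"
proof -
  define w where "w = l + (1 / b) *\<^sub>R (u - t)"
  have "conjugate h w = ereal (inner w t - \<phi> t)"
  proof (rule antisym)
    show "conjugate h w \<le> ereal (inner w t - \<phi> t)"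
      unfolding conjugate_def
    proof (rule SUP_least)
      fix y
      show "ereal (inner w y) - h y \<le> ereal (inner w t - \<phi> t)"
        using envelope_minimiser_subgradient[OF b t tmin, of y] unfolding w_def[symmetric]
        by (auto simp: h_eq inner_diff_right)
    qed
    show "ereal (inner w t - \<phi> t) \<le> conjugate h w"
      unfolding conjugate_def using t by (intro SUP_upper2[of t]) (auto simp: h_eq)
  qed
  hence "smooth_obj h u l b w = ereal (inner w u - (inner w t - \<phi> t) - b / 2 * (norm (w - l))\<^sup>2)"
    by (simp add: smooth_obj_def)
  also have "inner w u - (inner w t - \<phi> t) - b / 2 * (norm (w - l))\<^sup>2 = envelope_obj u l b t"
    using b unfolding envelope_obj_def power2_norm_eq_inner w_def
    by (simp add: inner_diff inner_add inner_commute algebra_simps) (simp add: field_simps)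
  finally show ?thesis unfolding w_def .
qed

lemma moreau_duality:
  assumes b: "0 < b"
  obtains t where "t \<in> C" and "smooth_argmax h u l b = l + (1 / b) *\<^sub>R (u - t)"
    and "smoothed h u l b = ereal (envelope_obj u l b t)"
    and "smooth_obj h u l b (smooth_argmax h u l b) = ereal (envelope_obj u l b t)"
proof -
  obtain t where t: "t \<in> C" and tmin: "\<And>y. y \<in> C \<Longrightarrow> envelope_obj u l b t \<le> envelope_obj u l b y"
    using envelope_minimiser_exists[OF b] by blast
  define w where "w = l + (1 / b) *\<^sub>R (u - t)"
  note eq = smooth_obj_eq_envelope[OF b t tmin, folded w_def]
  note le = smooth_obj_le_envelope[OF b t, of u l, folded w_def]
  have le': "smooth_obj h u l b v \<le> ereal (envelope_obj u l b t)" for v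
    by (rule order_trans[OF le]) (use b in auto)
  have am: "smooth_argmax h u l b = w"
    unfolding smooth_argmax_def
  proof (rule the_equality)
    show "is_arg_max (smooth_obj h u l b) (\<lambda>_. True) w"
      using eq le' by (auto simp: is_arg_max_def not_less)
    fix v assume "is_arg_max (smooth_obj h u l b) (\<lambda>_. True) v"
    hence "ereal (envelope_obj u l b t) \<le> smooth_obj h u l b v"
      using eq unfolding is_arg_max_def not_less by (metis not_le)
    from order_trans[OF this le] have "b / 2 * (norm (v - w))\<^sup>2 \<le> 0" by simp
    thus "v = w" using b by (simp add: mult_le_0_iff)
  qed
  have "smoothed h u l b = ereal (envelope_obj u l b t)"
    unfolding smoothed_def by (rule antisym[OF SUP_least SUP_upper2[of w]]) (use le' eq in auto)
  with that[of t] t am eq show ?thesis by (simp add: w_def)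
qed

lemma smoothed_le_envelope:
  assumes "0 < b" "t \<in> C"
  shows "smoothed h u l b \<le> ereal (envelope_obj u l b t)"
  unfolding smoothed_def
  by (rule SUP_least, rule order_trans[OF smooth_obj_le_envelope[OF assms]]) (use assms in auto)

lemma smooth_obj_strongly_concave:
  assumes "0 < b"
  shows "smooth_obj h u l b v + ereal (b / 2 * (norm (v - smooth_argmax h u l b))\<^sup>2) \<le> smoothed h u l b"
proof -
  obtain t where t: "t \<in> C" "smooth_argmax h u l b = l + (1 / b) *\<^sub>R (u - t)"
    "smoothed h u l b = ereal (envelope_obj u l b t)" using moreau_duality[OF assms] by metis
  show ?thesis using smooth_obj_le_envelope[OF assms t(1), of u l v] t
    by (cases "smooth_obj h u l b v") auto
qed

lemma smooth_argmax_attains: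
  assumes "0 < b"
  shows "smooth_obj h u l b (smooth_argmax h u l b) = smoothed h u l b"
  using moreau_duality[OF assms] by metis

lemma smoothed_finite:
  assumes "0 < b"
  shows "\<bar>smoothed h u l b\<bar> \<noteq> \<infinity>"
proof -
  obtain t where "smoothed h u l b = ereal (envelope_obj u l b t)"
    using moreau_duality[OF assms] by metis
  thus ?thesis by simp
qed

lemma conjugate_smooth_argmax:
  assumes "0 < b"
  obtains c where "conjugate h (smooth_argmax h u l b) = ereal c"
  using smooth_argmax_attains[OF assms, of u l] smoothed_finite[OF assms, of u l]
  by (cases "conjugate h (smooth_argmax h u l b)") (auto simp: smooth_obj_def)

text \<open>Effect of the multiplier update on the smoothed function. The objective with the old
  parameters is strongly concave around its maximiser \<open>l'\<close>; evaluate it at the new maximiser \<open>v\<close>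
  and estimate \<open>|v - l|\<^sup>2\<close> by \<open>2 |v - l'|\<^sup>2 + 2 |l' - l|\<^sup>2\<close>. Of the first term,
  the gain from strong concavity and the new penalty leave the coefficient \<open>(b - b') / 2\<close>.\<close>

lemma smoothed_update_le:
  fixes u l :: 'd and b b' :: real
  defines "l' \<equiv> smooth_argmax h u l b"
  assumes b: "0 < b" and b': "0 < b'"
  shows "smoothed h u l' b' \<le> smoothed h u l b
    + ereal (b * (norm (l' - l))\<^sup>2 + (b - b') / 2 * (norm (smooth_argmax h u l' b' - l'))\<^sup>2)"
proof -
  define v where "v = smooth_argmax h u l' b'"
  obtain c where c: "conjugate h v = ereal c" using conjugate_smooth_argmax[OF b'] v_def by metis
  obtain S where S: "smoothed h u l b = ereal S"
    using smoothed_finite[OF b, of u l] by (cases "smoothed h u l b") auto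
  have "inner v u - c - b / 2 * (norm (v - l))\<^sup>2 + b / 2 * (norm (v - l'))\<^sup>2 \<le> S"
    using smooth_obj_strongly_concave[OF b, of u l v] unfolding l'_def[symmetric] S
    by (simp add: smooth_obj_def c)
  moreover have "(norm (v - l))\<^sup>2 \<le> 2 * (norm (v - l'))\<^sup>2 + 2 * (norm (l' - l))\<^sup>2"
  proof -
    have "2 * (norm (v - l'))\<^sup>2 + 2 * (norm (l' - l))\<^sup>2 - (norm (v - l))\<^sup>2 = (norm (v - l' - (l' - l)))\<^sup>2"
      unfolding power2_norm_eq_inner by (simp add: inner_diff inner_commute algebra_simps)
    thus ?thesis by (metis diff_ge_0_iff_ge zero_le_power2)
  qed
  hence "b / 2 * (norm (v - l))\<^sup>2 \<le> b / 2 * (2 * (norm (v - l'))\<^sup>2 + 2 * (norm (l' - l))\<^sup>2)"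
    using b by (intro mult_left_mono) auto
  ultimately have "inner v u - c - b' / 2 * (norm (v - l'))\<^sup>2
      \<le> S + (b * (norm (l' - l))\<^sup>2 + (b - b') / 2 * (norm (v - l'))\<^sup>2)"
    by (simp add: field_simps)
  moreover have "smoothed h u l' b' = smooth_obj h u l' b' v"
    using smooth_argmax_attains[OF b'] v_def by simp
  ultimately show ?thesis unfolding v_def[symmetric] S by (simp add: smooth_obj_def c)
qed

text \<open>The multiplier update depends on its data only through \<open>u + b *\<^sub>R l\<close>, and strong concavity
  makes this dependence Lipschitz with constant \<open>1 / b\<close>: add the strong concavity inequalities of
  the two problems, each at the maximiser of the other.\<close>

lemma smooth_argmax_dist_le:
  assumes b: "0 < b"
  shows "b * norm (smooth_argmax h u l b - smooth_argmax h u' l' b)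
    \<le> norm ((u + b *\<^sub>R l) - (u' + b *\<^sub>R l'))"
proof -
  define w where "w = smooth_argmax h u l b"
  define w' where "w' = smooth_argmax h u' l' b"
  obtain c c' where c: "conjugate h w = ereal c" "conjugate h w' = ereal c'"
    using conjugate_smooth_argmax[OF b] w_def w'_def by metis
  have 1: "smooth_obj h u l b w' + ereal (b / 2 * (norm (w' - w))\<^sup>2) \<le> smooth_obj h u l b w"
    using smooth_obj_strongly_concave[OF b, of u l w'] smooth_argmax_attains[OF b, of u l]
    by (simp add: w_def)
  have 2: "smooth_obj h u' l' b w + ereal (b / 2 * (norm (w - w'))\<^sup>2) \<le> smooth_obj h u' l' b w'"
    using smooth_obj_strongly_concave[OF b, of u' l' w] smooth_argmax_attains[OF b, of u' l']
    by (simp add: w'_def)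
  have "b * (norm (w - w'))\<^sup>2 \<le> inner (w - w') ((u + b *\<^sub>R l) - (u' + b *\<^sub>R l'))"
    using 1 2 unfolding smooth_obj_def c power2_norm_eq_inner
    by (simp add: inner_diff inner_add inner_commute algebra_simps)
  also have "\<dots> \<le> norm (w - w') * norm ((u + b *\<^sub>R l) - (u' + b *\<^sub>R l'))"
    by (rule norm_cauchy_schwarz)
  finally have "norm (w - w') * (b * norm (w - w')) \<le> norm (w - w') * norm ((u + b *\<^sub>R l) - (u' + b *\<^sub>R l'))"
    by (simp add: power2_eq_square mult_ac)
  thus ?thesis unfolding w_def[symmetric] w'_def[symmetric]
    by (cases "w = w'") auto
qed

end

section \<open>Comparison of two consecutive stages\<close>

lemma norm_midpoint_sq:
  fixes a b :: "'a::real_inner"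
  shows "(norm (midpoint a b))\<^sup>2 = ((norm a)\<^sup>2 + (norm b)\<^sup>2) / 2 - (norm (a - b))\<^sup>2 / 4"
  unfolding midpoint_def power2_norm_eq_inner
  by (simp add: inner_diff inner_add inner_commute field_simps)

lemma norm_add_sq:
  fixes a b :: "'a::real_inner"
  shows "(norm (a + b))\<^sup>2 = (norm a)\<^sup>2 + 2 * inner a b + (norm b)\<^sup>2"
  unfolding power2_norm_eq_inner by (simp add: inner_add inner_commute)

text \<open>The price of replacing the proximal centre \<open>y\<close> by \<open>x\<close>. After expanding \<open>z - y\<close> as
  \<open>(z - x) + (x - y)\<close>, the mixed term is split by Young's inequality, weighted so that exactly the
  available curvature \<open>(2 * b' - b) / 4\<close> is spent on \<open>z - x\<close>; hence the assumption \<open>b / 2 < b'\<close>.\<close>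

lemma proximal_centre_shift:
  fixes x y z :: "'a::real_inner" and b b' :: real
  assumes "b / 2 < b'"
  shows "b / 2 * (norm (z - y))\<^sup>2 \<le> (b' / 2 + b / 4) * (norm (z - x))\<^sup>2
    + b / 2 * (norm (x - y))\<^sup>2 + b\<^sup>2 / (2 * b' - b) * (norm (y - x))\<^sup>2"
proof -
  define a where "a = z - x"
  define c where "c = x - y"
  define k where "k = 2 * b' - b"
  have k: "0 < k" using assms by (simp add: k_def)
  have "0 \<le> (norm ((k / 2) *\<^sub>R a + (- b) *\<^sub>R c))\<^sup>2 / k" using k by simp
  also have "\<dots> = k / 4 * (norm a)\<^sup>2 - b * inner a c + b\<^sup>2 / k * (norm c)\<^sup>2"
    unfolding norm_add_sq using k by (simp add: power_mult_distrib field_simps power2_eq_square)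
  finally have "b * inner a c \<le> k / 4 * (norm a)\<^sup>2 + b\<^sup>2 / k * (norm c)\<^sup>2" by simp
  moreover have "z - y = a + c" by (simp add: a_def c_def)
  hence "b / 2 * (norm (z - y))\<^sup>2 = b / 2 * (norm a)\<^sup>2 + b * inner a c + b / 2 * (norm c)\<^sup>2"
    by (simp add: norm_add_sq algebra_simps)
  moreover have "k / 4 * (norm a)\<^sup>2 = (b' / 2 - b / 4) * (norm a)\<^sup>2" by (simp add: k_def field_simps)
  ultimately show ?thesis
    unfolding a_def[symmetric] c_def[symmetric] k_def[symmetric] norm_minus_commute[of y x]
    by (simp add: algebra_simps)
qed

text \<open>Joint convexity is assumed in midpoint form, for the sum \<open>f + g\<close> and for \<open>\<phi>\<close> composed with
  the residuals. A residual of \<open>x\<close> is given as \<open>p x - t\<close>, by the point \<open>t\<close> of \<open>C\<close> that it leads to.\<close>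

locale smoothed_composite = lipschitz_restriction \<phi> C L h
  for \<phi> :: "'d::euclidean_space \<Rightarrow> real" and C :: "'d set" and L :: real and h :: "'d \<Rightarrow> ereal" +
  fixes f g :: "'a::euclidean_space \<Rightarrow> ereal" and p :: "'a \<Rightarrow> 'd"
  assumes not_minf: "\<And>z. f z + g z \<noteq> -\<infinity>"
    and proper: "\<exists>z. f z + g z \<noteq> \<infinity>"
    and sum_midpoint: "\<And>x z r s. f x + g x = ereal r \<Longrightarrow> f z + g z = ereal s \<Longrightarrow>
      f (midpoint x z) + g (midpoint x z) \<le> ereal ((r + s) / 2)"
    and residual_midpoint: "\<And>x z t s. t \<in> C \<Longrightarrow> s \<in> C \<Longrightarrow>
      p (midpoint x z) - midpoint (p x - t) (p z - s) \<in> C \<and>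
      \<phi> (p (midpoint x z) - midpoint (p x - t) (p z - s)) \<le> (\<phi> t + \<phi> s) / 2"
begin

text \<open>The infimum of the next stage, from below. At the midpoint of \<open>x\<close> and \<open>z\<close>, with the midpoint
  of their residuals \<open>Z\<close> and \<open>Z'\<close>, the objective of the current stage is at least \<open>N\<close>. Joint strong
  convexity bounds the current objective at \<open>z\<close> with residual \<open>Z'\<close> from below by \<open>2 * N - r\<close> plus
  \<open>|Z - Z'|\<^sup>2 / (4 * b)\<close> plus \<open>b / 4 * |z - x|\<^sup>2\<close>. In the next stage the multiplier has grown by
  \<open>Z / b\<close>, which adds \<open>inner Z Z' / b\<close>; together with the first gain this is a square. The second
  gain pays for the new centre.\<close>

lemma next_stage_lower_bound:
  fixes b b' :: real
  assumes b: "0 < b" and b': "0 < b'" and dec: "b' \<le> b" "b / 2 < b'"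
    and N: "\<And>w. ereal N \<le> prox_lagrangian f g h p w y l b"
    and r: "prox_lagrangian f g h p x y l b = ereal r"
  shows "ereal (2 * N - r - b / 2 * (norm (x - y))\<^sup>2 - b\<^sup>2 / (2 * b' - b) * (norm (y - x))\<^sup>2)
    \<le> prox_lagrangian f g h p z x (smooth_argmax h (p x) l b) b'"
proof (cases "f z + g z = \<infinity>")
  case True
  show ?thesis unfolding prox_lagrangian_def True
    using smoothed_finite[OF b', of "p z" "smooth_argmax h (p x) l b"]
    by (cases "smoothed h (p z) (smooth_argmax h (p x) l b) b'") auto
next
  case False
  then obtain Gz where Gz: "f z + g z = ereal Gz"
    using not_minf[of z] by (cases "f z + g z") auto
  obtain t where t: "t \<in> C" and l': "smooth_argmax h (p x) l b = l + (1 / b) *\<^sub>R (p x - t)"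
    and St: "smoothed h (p x) l b = ereal (envelope_obj (p x) l b t)"
    using moreau_duality[OF b] by metis
  obtain Gx where Gx: "f x + g x = ereal Gx"
    using r by (cases "f x + g x") (auto simp: prox_lagrangian_def St)
  define l' where "l' = l + (1 / b) *\<^sub>R (p x - t)"
  obtain t' where t': "t' \<in> C" and St': "smoothed h (p z) l' b' = ereal (envelope_obj (p z) l' b' t')"
    using moreau_duality[OF b'] by metis
  define X where "X = midpoint x z"
  define Z where "Z = p x - t"
  define Z' where "Z' = p z - t'"
  define T where "T = p X - midpoint Z Z'"
  have T: "T \<in> C" "\<phi> T \<le> (\<phi> t + \<phi> t') / 2"
    using residual_midpoint[OF t t', of x z] by (simp_all add: T_def X_def Z_def Z'_def)
  have "ereal N \<le> f X + g X + smoothed h (p X) l b + ereal (b / 2 * (norm (X - y))\<^sup>2)"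
    using N[of X] by (simp add: prox_lagrangian_def)
  also have "\<dots> \<le> ereal ((Gx + Gz) / 2) + ereal (envelope_obj (p X) l b T) + ereal (b / 2 * (norm (X - y))\<^sup>2)"
    unfolding X_def
    by (intro add_mono sum_midpoint[OF Gx Gz] smoothed_le_envelope[OF b T(1)[unfolded X_def]] order_refl)
  finally have 1: "N \<le> (Gx + Gz) / 2 + envelope_obj (p X) l b T + b / 2 * (norm (X - y))\<^sup>2"
    by simp
  have r_eq: "r = Gx + (\<phi> t + inner l Z + (norm Z)\<^sup>2 / (2 * b)) + b / 2 * (norm (x - y))\<^sup>2"
    using r by (simp add: prox_lagrangian_def Gx St envelope_obj_def Z_def)
  have "envelope_obj (p X) l b T = \<phi> T + inner l (midpoint Z Z') + (norm (midpoint Z Z'))\<^sup>2 / (2 * b)"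
    by (simp add: envelope_obj_def T_def)
  also have "\<dots> = \<phi> T + (inner l Z + inner l Z') / 2 
      + ((norm Z)\<^sup>2 / (2 * b) + (norm Z')\<^sup>2 / (2 * b)) / 2 - (norm (Z - Z'))\<^sup>2 / (4 * b) / 2"
    unfolding norm_midpoint_sq using b by (simp add: midpoint_def inner_add_right field_simps)
  finally have eT: "envelope_obj (p X) l b T = \<phi> T + (inner l Z + inner l Z') / 2 
      + ((norm Z)\<^sup>2 / (2 * b) + (norm Z')\<^sup>2 / (2 * b)) / 2 - (norm (Z - Z'))\<^sup>2 / (4 * b) / 2" .
  have "X - y = midpoint (x - y) (z - y)"
    by (simp add: X_def midpoint_def field_simps scaleR_2[symmetric])
  hence X_y: "(norm (X - y))\<^sup>2 = ((norm (x - y))\<^sup>2 + (norm (z - y))\<^sup>2) / 2 - (norm (z - x))\<^sup>2 / 4"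
    using norm_midpoint_sq[of "x - y" "z - y"] by (simp add: norm_minus_commute)
  have eX: "b / 2 * (norm (X - y))\<^sup>2 = b / 4 * (norm (x - y))\<^sup>2 + b / 4 * (norm (z - y))\<^sup>2 - b / 8 * (norm (z - x))\<^sup>2"
    unfolding X_y by (simp add: field_simps)
  have 2: "2 * N - r \<le> Gz + \<phi> t' + inner l Z' + (norm Z')\<^sup>2 / (2 * b) - (norm (Z - Z'))\<^sup>2 / (4 * b)
      + b / 2 * (norm (z - y))\<^sup>2 - b / 4 * (norm (z - x))\<^sup>2"
    using 1 T(2) unfolding eT eX r_eq by argo
  \<comment> \<open>the new multiplier and the convexity gain in the residual combine to a square\<close>
  have cross: "inner Z Z' / b + (norm (Z - Z'))\<^sup>2 / (4 * b) = (norm (Z + Z'))\<^sup>2 / (4 * b)"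
    using b unfolding power2_norm_eq_inner by (simp add: inner_diff inner_add inner_commute field_simps)
  \<comment> \<open>a smaller parameter weighs the residual more heavily\<close>
  have "(norm Z')\<^sup>2 / (2 * b) \<le> (norm Z')\<^sup>2 / (2 * b')"
    using b' dec by (intro divide_left_mono) auto
  hence 3: "inner l Z' + (norm Z')\<^sup>2 / (2 * b) - (norm (Z - Z'))\<^sup>2 / (4 * b) \<le> inner l Z' + inner Z Z' / b + (norm Z')\<^sup>2 / (2 * b')"
    using cross b by (smt (verit) divide_nonneg_pos zero_le_power2)
  have 4: "envelope_obj (p z) l' b' t' = \<phi> t' + (inner l Z' + inner Z Z' / b) + (norm Z')\<^sup>2 / (2 * b')"
    by (simp add: envelope_obj_def l'_def Z_def[symmetric] Z'_def[symmetric] inner_add_left)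
  show ?thesis unfolding l' l'_def[symmetric]
    using 2 3 proximal_centre_shift[OF dec(2), of z y x]
    by (simp add: prox_lagrangian_def Gz St' 4 algebra_simps)
qed

lemma next_stage_value_at_centre:
  fixes b b' :: real and x :: 'a and l :: 'd
  defines "l' \<equiv> smooth_argmax h (p x) l b"
  assumes b: "0 < b" "0 < b'" and r: "prox_lagrangian f g h p x y l b = ereal r"
  shows "prox_lagrangian f g h p x x l' b' \<le> ereal (r - b / 2 * (norm (x - y))\<^sup>2
    + (b * (norm (l' - l))\<^sup>2 + (b - b') / 2 * (norm (smooth_argmax h (p x) l' b' - l'))\<^sup>2))"
proof -
  obtain S where S: "smoothed h (p x) l b = ereal S"
    using smoothed_finite[OF b(1), of "p x" l] by (cases "smoothed h (p x) l b") auto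
  obtain S' where S': "smoothed h (p x) l' b' = ereal S'"
    using smoothed_finite[OF b(2), of "p x" l'] by (cases "smoothed h (p x) l' b'") auto
  obtain G where G: "f x + g x = ereal G"
    using r by (cases "f x + g x") (auto simp: prox_lagrangian_def S)
  show ?thesis using smoothed_update_le[OF b, of "p x" l] r
    unfolding l'_def[symmetric] by (simp add: prox_lagrangian_def G S S')
qed

text \<open>When the current stage is unbounded below or \<open>x\<close> is infeasible, its gap is infinite and the
  bound is trivial; otherwise subtract the two estimates above. The gap counts twice, once through
  the value at \<open>x\<close> and once through the midpoint argument.\<close>

lemma opt_gap_next_stage_le:
  fixes b b' :: real and x y :: 'a and l :: 'd
  defines "l' \<equiv> smooth_argmax h (p x) l b"
  defines "drift \<equiv> b * (norm (l' - l))\<^sup>2 + (b - b') / 2 * (norm (smooth_argmax h (p x) l' b' - l'))\<^sup>2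
    + b\<^sup>2 / (2 * b' - b) * (norm (y - x))\<^sup>2"
  assumes b: "0 < b" "0 < b'" and dec: "b' \<le> b" "b / 2 < b'"
  shows "opt_gap (\<lambda>w. prox_lagrangian f g h p w x l' b') x
    \<le> 2 * opt_gap (\<lambda>w. prox_lagrangian f g h p w y l b) x + ennreal drift"
proof -
  let ?P = "\<lambda>w. prox_lagrangian f g h p w y l b"
  let ?Q = "\<lambda>w. prox_lagrangian f g h p w x l' b'"
  have fin: "?P w \<noteq> -\<infinity>" "f w + g w \<noteq> \<infinity> \<Longrightarrow> ?P w \<noteq> \<infinity>" for w
    using smoothed_finite[OF b(1), of "p w" l] not_minf[of w]
    by (cases "smoothed h (p w) l b"; cases "f w + g w"; simp add: prox_lagrangian_def)+
  obtain z0 where "?P z0 \<noteq> \<infinity>" using proper fin(2) by blast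
  hence I_lt: "(INF w. ?P w) \<noteq> \<infinity>"
    by (metis INF_lower UNIV_I ereal_infty_less_eq(1))
  show ?thesis
  proof (cases "(INF w. ?P w) = -\<infinity> \<or> ?P x = \<infinity>")
    case True
    hence "?P x - (INF w. ?P w) = \<infinity>"
      using I_lt fin(1)[of x] by (cases "?P x"; cases "INF w. ?P w") auto
    hence "opt_gap ?P x = \<top>" by (simp add: opt_gap_def)
    thus ?thesis by (simp add: ennreal_mult_top)
  next
    case False
    then obtain N r where N: "(INF w. ?P w) = ereal N" and r: "?P x = ereal r"
      using I_lt fin(1)[of x] by (cases "?P x"; cases "INF w. ?P w") auto
    have NP: "ereal N \<le> ?P w" for w unfolding N[symmetric] by (rule INF_lower) simp
    define M where "M = 2 * N - r - b / 2 * (norm (x - y))\<^sup>2 - b\<^sup>2 / (2 * b' - b) * (norm (y - x))\<^sup>2"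
    define r' where "r' = r - b / 2 * (norm (x - y))\<^sup>2
      + (b * (norm (l' - l))\<^sup>2 + (b - b') / 2 * (norm (smooth_argmax h (p x) l' b' - l'))\<^sup>2)"
    have lower: "ereal M \<le> (INF w. ?Q w)"
      unfolding M_def l'_def by (rule INF_greatest, rule next_stage_lower_bound[OF b dec NP r])
    have upper: "?Q x \<le> ereal r'"
      unfolding r'_def l'_def by (rule next_stage_value_at_centre[OF b r])
    have "?Q x - (INF w. ?Q w) \<le> ereal r' - ereal M"
      by (rule ereal_minus_mono[OF upper lower])
    hence "opt_gap ?Q x \<le> ennreal (r' - M)"
      unfolding opt_gap_def by (metis e2ennreal_ereal e2ennreal_mono ereal_minus(1))
    also have "r' - M = 2 * (r - N) + drift"
      by (simp add: r'_def M_def drift_def)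
    also have "ennreal \<dots> = 2 * ennreal (r - N) + ennreal drift"
    proof -
      have "0 \<le> drift" unfolding drift_def using b dec by (intro add_nonneg_nonneg) auto
      moreover have "0 \<le> r - N" using NP[of x] unfolding r by simp
      ultimately show ?thesis using ennreal_mult[of 2 "r - N"] by (simp only: ennreal_plus) simp
    qed
    also have "ennreal (r - N) = opt_gap ?P x"
      by (simp add: opt_gap_def N r)
    finally show ?thesis .
  qed
qed

end

section \<open>Measurability\<close>

context lipschitz_restriction
begin

text \<open>A supremum of functions that are continuous in \<open>(u, l)\<close> is lower semicontinuous.\<close>

lemma open_smoothed_gt:
  shows "open {(u, l). a < smoothed h u l b}"
proof -
  have "open {x. a < smooth_obj h (fst x) (snd x) b v}" for v
  proof (cases "conjugate h v")
    case (real c)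
    have "continuous_on UNIV (\<lambda>x::'d \<times> 'd. ereal (inner v (fst x) - c - b / 2 * (norm (v - snd x))\<^sup>2))"
      by (intro continuous_intros)
    moreover have "smooth_obj h (fst x) (snd x) b v = ereal (inner v (fst x) - c - b / 2 * (norm (v - snd x))\<^sup>2)"
      for x by (simp add: smooth_obj_def real)
    ultimately show ?thesis by (simp add: open_Collect_less)
  qed (simp_all add: smooth_obj_def)
  hence "open (\<Union>v. {x. a < smooth_obj h (fst x) (snd x) b v})" by blast
  also have "(\<Union>v. {x. a < smooth_obj h (fst x) (snd x) b v}) = {(u, l). a < smoothed h u l b}"
    by (auto simp: smoothed_def less_SUP_iff)
  finally show ?thesis .
qed

lemma borel_measurable_smoothed:
  "(\<lambda>(u, l). smoothed h u l b) \<in> borel_measurable borel"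
  by (rule borel_measurableI_greater) (use borel_open[OF open_smoothed_gt] in \<open>simp add: case_prod_unfold\<close>)

lemma continuous_smooth_argmax:
  assumes b: "0 < b"
  shows "continuous_on UNIV (\<lambda>(u, l). smooth_argmax h u l b)"
proof -
  have "((\<lambda>x. smooth_argmax h (fst x) (snd x) b) \<longlongrightarrow> smooth_argmax h (fst x0) (snd x0) b) (at x0)" for x0
    unfolding tendsto_iff dist_norm[of "smooth_argmax _ _ _ _"]
  proof (intro allI impI)
    fix e :: real assume e: "0 < e"
    have "((\<lambda>x. norm ((fst x + b *\<^sub>R snd x) - (fst x0 + b *\<^sub>R snd x0)))
        \<longlongrightarrow> norm ((fst x0 + b *\<^sub>R snd x0) - (fst x0 + b *\<^sub>R snd x0))) (at x0)"
      by (intro tendsto_intros)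
    hence "\<forall>\<^sub>F x in at x0. norm ((fst x + b *\<^sub>R snd x) - (fst x0 + b *\<^sub>R snd x0)) < b * e"
      by (rule order_tendstoD(2)) (use b e in simp)
    thus "\<forall>\<^sub>F x in at x0. norm (smooth_argmax h (fst x) (snd x) b - smooth_argmax h (fst x0) (snd x0) b) < e"
    proof eventually_elim
      case (elim x)
      have "b * norm (smooth_argmax h (fst x) (snd x) b - smooth_argmax h (fst x0) (snd x0) b) < b * e"
        using smooth_argmax_dist_le[OF b] elim by (rule le_less_trans)
      thus ?case using b by simp
    qed
  qed
  thus ?thesis by (simp add: continuous_on_def case_prod_beta)
qed

lemma borel_measurable_smooth_argmax:
  assumes "0 < b" and [measurable]: "u \<in> borel_measurable M" "l \<in> borel_measurable M"
  shows "(\<lambda>\<omega>. smooth_argmax h (u \<omega>) (l \<omega>) b) \<in> borel_measurable M"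
proof -
  have "(\<lambda>\<omega>. (u \<omega>, l \<omega>)) \<in> borel_measurable M" by measurable
  from measurable_compose[OF this borel_measurable_continuous_onI[OF continuous_smooth_argmax[OF assms(1)]]]
  show ?thesis by simp
qed

end

context smoothed_composite
begin

text \<open>By Moreau duality the optimal value of a stage is an infimum over pairs \<open>(w, t)\<close> of functions
  that are continuous in the centre and the multiplier; so it is upper semicontinuous, although the
  infimum ranges over an uncountable set.\<close>

lemma open_stage_inf_less:
  assumes b: "0 < b"
  shows "open {(y, l). (INF w. prox_lagrangian f g h p w y l b) < a}"
proof -
  define \<Psi> where "\<Psi> = (\<lambda>w t x. f w + g w + ereal (envelope_obj (p w) (snd x) b t)
    + ereal (b / 2 * (norm (w - fst x))\<^sup>2))"
  have "open {x. \<Psi> w t x < a}" for w t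
  proof (cases "f w + g w")
    case (real c)
    have "continuous_on UNIV (\<lambda>x::'a \<times> 'd. ereal (c + envelope_obj (p w) (snd x) b t + b / 2 * (norm (w - fst x))\<^sup>2))"
      unfolding envelope_obj_def by (intro continuous_intros) (use b in auto)
    moreover have "\<Psi> w t x = ereal (c + envelope_obj (p w) (snd x) b t + b / 2 * (norm (w - fst x))\<^sup>2)" for x
      by (simp add: \<Psi>_def real)
    ultimately show ?thesis by (simp add: open_Collect_less)
  next
    case PInf
    show ?thesis unfolding \<Psi>_def PInf by simp
  next
    case MInf
    thus ?thesis using not_minf by blast
  qed
  hence "open (\<Union>w. \<Union>t\<in>C. {x. \<Psi> w t x < a})" by blast
  also have "(\<Union>w. \<Union>t\<in>C. {x. \<Psi> w t x < a}) = {(y, l). (INF w. prox_lagrangian f g h p w y l b) < a}"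
  proof -
    have "(\<exists>t\<in>C. \<Psi> w t (y, l) < a) \<longleftrightarrow> prox_lagrangian f g h p w y l b < a" for w y l
    proof
      assume "\<exists>t\<in>C. \<Psi> w t (y, l) < a"
      then obtain t where t: "t \<in> C" "\<Psi> w t (y, l) < a" by blast
      have "prox_lagrangian f g h p w y l b \<le> \<Psi> w t (y, l)"
        unfolding prox_lagrangian_def \<Psi>_def fst_conv snd_conv
        by (intro add_mono smoothed_le_envelope[OF b t(1)] order_refl)
      with t(2) show "prox_lagrangian f g h p w y l b < a" by simp
    next
      assume "prox_lagrangian f g h p w y l b < a"
      moreover obtain t where "t \<in> C" "smoothed h (p w) l b = ereal (envelope_obj (p w) l b t)"
        using moreau_duality[OF b] by metis
      ultimately show "\<exists>t\<in>C. \<Psi> w t (y, l) < a"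
        by (auto simp: \<Psi>_def prox_lagrangian_def intro!: bexI[of _ t])
    qed
    from this[symmetric] show ?thesis by (auto simp: INF_less_iff)
  qed
  finally show ?thesis .
qed

lemma borel_measurable_opt_gap:
  assumes b: "0 < b"
    and [measurable]: "(\<lambda>w. f w + g w) \<in> borel_measurable borel" "p \<in> borel_measurable borel"
    and [measurable]: "x \<in> borel_measurable M" "y \<in> borel_measurable M" "l \<in> borel_measurable M"
  shows "(\<lambda>\<omega>. opt_gap (\<lambda>w. prox_lagrangian f g h p w (y \<omega>) (l \<omega>) b) (x \<omega>)) \<in> borel_measurable M"
proof -
  have [measurable]: "(\<lambda>\<omega>. smoothed h (p (x \<omega>)) (l \<omega>) b) \<in> borel_measurable M"
  proof -
    have "(\<lambda>\<omega>. (p (x \<omega>), l \<omega>)) \<in> borel_measurable M" by measurable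
    from measurable_compose[OF this borel_measurable_smoothed] show ?thesis by simp
  qed
  have [measurable]: "(\<lambda>\<omega>. f (x \<omega>) + g (x \<omega>)) \<in> borel_measurable M"
    using measurable_compose[OF assms(4,2)] .
  have [measurable]: "(\<lambda>\<omega>. INF w. prox_lagrangian f g h p w (y \<omega>) (l \<omega>) b) \<in> borel_measurable M"
  proof -
    have inf: "(\<lambda>(y, l). INF w. prox_lagrangian f g h p w y l b) \<in> borel_measurable borel"
      by (rule borel_measurableI_less) (use borel_open[OF open_stage_inf_less[OF b]] in \<open>simp add: case_prod_unfold\<close>)
    have "(\<lambda>\<omega>. (y \<omega>, l \<omega>)) \<in> borel_measurable M" by measurable
    from measurable_compose[OF this inf] show ?thesis by simp
  qed
  have "(\<lambda>\<omega>. prox_lagrangian f g h p (x \<omega>) (y \<omega>) (l \<omega>) b) \<in> borel_measurable M"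
    unfolding prox_lagrangian_def by measurable
  thus ?thesis unfolding opt_gap_def by measurable
qed

lemma opt_gap_finite_imp:
  assumes b: "0 < b" and fin: "opt_gap (\<lambda>w. prox_lagrangian f g h p w y l b) x \<noteq> \<top>"
  shows "f x + g x \<noteq> \<infinity>"
proof
  assume x: "f x + g x = \<infinity>"
  obtain z where "f z + g z \<noteq> \<infinity>" using proper by blast
  hence "prox_lagrangian f g h p z y l b \<noteq> \<infinity>"
    using smoothed_finite[OF b, of "p z" l] by (auto simp: prox_lagrangian_def)
  hence "(INF w. prox_lagrangian f g h p w y l b) \<noteq> \<infinity>"
    by (metis INF_lower UNIV_I ereal_infty_less_eq(1))
  moreover have "prox_lagrangian f g h p x y l b = \<infinity>"
    unfolding prox_lagrangian_def x using smoothed_finite[OF b, of "p x" l]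
    by (cases "smoothed h (p x) l b") auto
  ultimately have "opt_gap (\<lambda>w. prox_lagrangian f g h p w y l b) x = \<top>"
    unfolding opt_gap_def by (cases "INF w. prox_lagrangian f g h p w y l b") auto
  with fin show False by simp
qed

end

lemma borel_measurable_closed_fun:
  fixes g :: "'a::euclidean_space \<Rightarrow> ereal"
  assumes "closed_fun g" "proper_fun g"
  shows "g \<in> borel_measurable borel"
proof (rule borel_measurableI_le)
  fix a :: ereal
  have "closed {x. g x \<le> a}"
  proof (cases a)
    case (real r)
    have "closed ((\<lambda>x. (x, r)) -` epi g)"
      using assms(1) unfolding closed_fun_def by (rule closed_vimage) (intro continuous_intros)
    thus ?thesis by (simp add: epi_def real vimage_def)
  next
    case MInf
    with assms(2) show ?thesis by (simp add: proper_fun_def)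
  qed simp
  thus "{x \<in> space borel. g x \<le> a} \<in> sets borel" by simp
qed

text \<open>Near \<open>edom g\<close> the function \<open>f\<close> is continuous; elsewhere the sum is infinite.\<close>

lemma borel_measurable_sum_differentiable_near:
  fixes f g :: "'a::euclidean_space \<Rightarrow> ereal"
  assumes g: "g \<in> borel_measurable borel" and f: "\<And>z. f z \<noteq> -\<infinity>" "differentiable_near f (edom g)"
  shows "(\<lambda>z. f z + g z) \<in> borel_measurable borel"
proof -
  obtain U where U: "open U \<and> edom g \<subseteq> U \<and> (\<forall>z\<in>U. \<bar>f z\<bar> \<noteq> \<infinity>) \<and>
      (\<forall>z\<in>U. (\<lambda>y. real_of_ereal (f y)) differentiable (at z))"
    using f(2) unfolding differentiable_near_def ..
  have "continuous_on U (\<lambda>y. real_of_ereal (f y))"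
  proof (rule continuous_at_imp_continuous_on, rule ballI)
    fix z assume "z \<in> U"
    show "isCont (\<lambda>y. real_of_ereal (f y)) z"
      by (rule differentiable_imp_continuous_within) (use U \<open>z \<in> U\<close> in blast)
  qed
  hence [measurable]: "(\<lambda>z. if z \<in> U then real_of_ereal (f z) else 0) \<in> borel_measurable borel"
    using U by (intro borel_measurable_continuous_on_if) auto
  note g[measurable]
  have "f z + g z = (if g z < \<infinity> then ereal (if z \<in> U then real_of_ereal (f z) else 0) + g z else \<infinity>)" for z
    using U f(1)[of z] by (auto simp: edom_def ereal_real)
  hence "(\<lambda>z. f z + g z) = (\<lambda>z. if g z < \<infinity> then ereal (if z \<in> U then real_of_ereal (f z) else 0) + g z else \<infinity>)"
    by auto
  also have "\<dots> \<in> borel_measurable borel" by measurable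
  finally show ?thesis .
qed

section \<open>Expectations\<close>

text \<open>The conditional expectation given a past that is not contained in the sigma-algebra of \<open>M\<close>
  would be \<open>0\<close> by convention.\<close>

lemma subalgebra_history:
  assumes "\<And>t. x t \<in> borel_measurable M" "\<And>t. lam t \<in> borel_measurable M"
  shows "subalgebra M (history M x lam s)"
proof -
  let ?A = "\<Union>t<s. {x t -` B \<inter> space M | B. B \<in> sets borel} \<union> {lam t -` B \<inter> space M | B. B \<in> sets borel}"
  have "?A \<subseteq> sets M" using assms by (auto simp: measurable_sets)
  hence "sigma_sets (space M) ?A \<subseteq> sets M" by (rule sets.sigma_sets_subset)
  moreover have "?A \<subseteq> Pow (space M)" by auto
  ultimately show ?thesis
    by (simp add: subalgebra_def history_def space_measure_of_conv sets_measure_of)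
qed

lemma measurable_history:
  assumes "t < s"
  shows "x t \<in> borel_measurable (history M x lam s)"
proof (rule measurableI)
  let ?A = "\<Union>t<s. {x t -` B \<inter> space M | B. B \<in> sets borel} \<union> {lam t -` B \<inter> space M | B. B \<in> sets borel}"
  fix B :: "'b set" assume "B \<in> sets borel"
  hence "x t -` B \<inter> space M \<in> ?A" using assms by blast
  moreover have "?A \<subseteq> Pow (space M)" by auto
  ultimately show "x t -` B \<inter> space (history M x lam s) \<in> sets (history M x lam s)"
    by (simp add: history_def space_measure_of_conv sets_measure_of sigma_sets.Basic)
qed simp

text \<open>The conditional bound integrates to an unconditional one. The solver requirement speaks of
  starting points that lie in \<open>S\<close> for every outcome; a starting point that does so only almost
  surely is first replaced on a null set.\<close>

lemma nn_integral_opt_gap_solver_le: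
  fixes x :: "'w \<Rightarrow> 'a::euclidean_space"
  assumes "prob_space M" and F: "subalgebra M F"
    and conv: "lin_convergent M F S H \<A> \<xi> \<kappa>"
    and S: "S \<in> sets borel" "z0 \<in> S"
    and x: "x \<in> borel_measurable F" "AE \<omega> in M. x \<omega> \<in> S"
    and k: "k \<in> F \<rightarrow>\<^sub>M count_space UNIV"
    and gap: "\<And>y. y \<in> borel_measurable M \<Longrightarrow> (\<lambda>\<omega>. opt_gap (H \<omega>) (y \<omega>)) \<in> borel_measurable M"
  shows "(\<integral>\<^sup>+ \<omega>. opt_gap (H \<omega>) (\<A> (\<xi> \<omega>) (x \<omega>) (k \<omega>) (H \<omega>)) \<partial>M)
    \<le> (\<integral>\<^sup>+ \<omega>. ennreal (2 powi (- \<lfloor>real (k \<omega>) / \<kappa>\<rfloor>)) * opt_gap (H \<omega>) (x \<omega>) \<partial>M)"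
proof -
  interpret prob_space M by fact
  interpret sigma_finite_subalgebra M F
    by (rule finite_measure_subalgebra_is_sigma_finite)
      (simp add: finite_measure_subalgebra_def finite_measure_subalgebra_axioms_def F finite_measure_axioms)
  define z where "z = (\<lambda>\<omega>. if x \<omega> \<in> S then x \<omega> else z0)"
  have z: "z \<in> borel_measurable F" "\<And>\<omega>. z \<omega> \<in> S"
    unfolding z_def using measurable_If[OF x(1) measurable_const] measurable_sets[OF x(1) S(1)] S(2)
    by (auto simp: vimage_def Int_def conj_commute)
  have zx: "AE \<omega> in M. z \<omega> = x \<omega>" using x(2) by eventually_elim (simp add: z_def)
  define Y where "Y = (\<lambda>\<omega>. \<A> (\<xi> \<omega>) (z \<omega>) (k \<omega>) (H \<omega>))"
  have Y: "Y \<in> borel_measurable M"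
    and le: "AE \<omega> in M. nn_cond_exp M F (\<lambda>\<omega>. opt_gap (H \<omega>) (Y \<omega>)) \<omega>
             \<le> ennreal (2 powi (- \<lfloor>real (k \<omega>) / \<kappa>\<rfloor>)) * opt_gap (H \<omega>) (z \<omega>)"
    using conv z k unfolding lin_convergent_def Y_def by auto
  have "(\<integral>\<^sup>+ \<omega>. opt_gap (H \<omega>) (\<A> (\<xi> \<omega>) (x \<omega>) (k \<omega>) (H \<omega>)) \<partial>M) = (\<integral>\<^sup>+ \<omega>. opt_gap (H \<omega>) (Y \<omega>) \<partial>M)"
    by (rule nn_integral_cong_AE) (use zx in \<open>auto simp: Y_def\<close>)
  also have "\<dots> = (\<integral>\<^sup>+ \<omega>. nn_cond_exp M F (\<lambda>\<omega>. opt_gap (H \<omega>) (Y \<omega>)) \<omega> \<partial>M)"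
    using nn_cond_exp_intg[of "\<lambda>_. 1" "\<lambda>\<omega>. opt_gap (H \<omega>) (Y \<omega>)"] gap[OF Y] by simp
  also have "\<dots> \<le> (\<integral>\<^sup>+ \<omega>. ennreal (2 powi (- \<lfloor>real (k \<omega>) / \<kappa>\<rfloor>)) * opt_gap (H \<omega>) (x \<omega>) \<partial>M)"
    by (rule nn_integral_mono_AE) (use le zx in auto)
  finally show ?thesis .
qed

text \<open>Here \<open>q\<close> and \<open>D\<close> may depend on \<open>G\<close>. The pointwise hypothesis forces \<open>q \<le> e' / (4 * e)\<close>, so a
  constant replaces \<open>q\<close> in front of \<open>G\<close> before integrating.\<close>

lemma discounted_nn_integral_le:
  fixes q D :: "'w \<Rightarrow> real" and G G' :: "'w \<Rightarrow> ennreal" and e e' :: real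
  assumes "prob_space M" and e: "0 < e" and e': "0 < e'"
    and G: "G \<in> borel_measurable M" "(\<integral>\<^sup>+ \<omega>. G \<omega> \<partial>M) \<le> ennreal e"
    and q: "\<And>\<omega>. 0 \<le> q \<omega>" and D: "\<And>\<omega>. 0 \<le> D \<omega>"
    and qD: "AE \<omega> in M. q \<omega> * (2 * e + D \<omega>) \<le> e' / 2"
    and G': "AE \<omega> in M. G' \<omega> \<le> 2 * G \<omega> + ennreal (D \<omega>)"
  shows "(\<integral>\<^sup>+ \<omega>. ennreal (q \<omega>) * G' \<omega> \<partial>M) \<le> ennreal e'"
proof -
  interpret prob_space M by fact
  have "(\<integral>\<^sup>+ \<omega>. ennreal (q \<omega>) * G' \<omega> \<partial>M) \<le> (\<integral>\<^sup>+ \<omega>. ennreal (e' / (2 * e)) * G \<omega> + ennreal (e' / 2) \<partial>M)"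
  proof (rule nn_integral_mono_AE)
    show "AE \<omega> in M. ennreal (q \<omega>) * G' \<omega> \<le> ennreal (e' / (2 * e)) * G \<omega> + ennreal (e' / 2)"
      using qD G'
    proof eventually_elim
      case (elim \<omega>)
      have nn: "0 \<le> q \<omega> * D \<omega>" "0 \<le> q \<omega> * e" using q D e by auto
      have bound: "4 * (q \<omega> * e) + 2 * (q \<omega> * D \<omega>) \<le> e'" using elim(1) by (simp add: algebra_simps)
      have "ennreal (q \<omega>) * G' \<omega> \<le> ennreal (q \<omega>) * (2 * G \<omega> + ennreal (D \<omega>))"
        by (rule mult_left_mono) (use elim in auto)
      also have "\<dots> = ennreal (q \<omega> * 2) * G \<omega> + ennreal (q \<omega> * D \<omega>)"
        using q[of \<omega>] D[of \<omega>] by (simp add: distrib_left ennreal_mult mult.assoc)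
      also have "\<dots> \<le> ennreal (e' / (2 * e)) * G \<omega> + ennreal (e' / 2)"
      proof (intro add_mono mult_right_mono ennreal_leI)
        show "q \<omega> * 2 \<le> e' / (2 * e)" using bound nn e by (simp add: field_simps)
        show "q \<omega> * D \<omega> \<le> e' / 2" using bound nn by linarith
      qed auto
      finally show ?case .
    qed
  qed
  also have "\<dots> = ennreal (e' / (2 * e)) * (\<integral>\<^sup>+ \<omega>. G \<omega> \<partial>M) + ennreal (e' / 2)"
    using G(1) by (simp add: nn_integral_add nn_integral_cmult emeasure_space_1)
  also have "\<dots> \<le> ennreal (e' / (2 * e)) * ennreal e + ennreal (e' / 2)"
    by (intro add_mono mult_left_mono G(2)) auto
  also have "\<dots> = ennreal (e' / 2) + ennreal (e' / 2)"
    using e e' by (simp add: ennreal_mult[symmetric])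
  also have "\<dots> = ennreal e'" using e' by (simp add: ennreal_plus[symmetric] del: ennreal_plus)
  finally show ?thesis .
qed

section \<open>Accuracy of the next stage\<close>

lemma convex_fun_midpoint:
  assumes "convex_fun \<phi>" "\<phi> x \<le> ereal r" "\<phi> z \<le> ereal s"
  shows "\<phi> (midpoint x z) \<le> ereal ((r + s) / 2)"
  using convexD[of "epi \<phi>" "(x, r)" "(z, s)" "1/2" "1/2"] assms
  by (simp add: convex_fun_def epi_def midpoint_def scaleR_add_right add_divide_distrib)

lemma convex_on_of_convex_fun:
  fixes \<phi> :: "'a::real_vector \<Rightarrow> real"
  assumes "convex_fun (\<lambda>u. ereal (\<phi> u))"
  shows "convex_on UNIV \<phi>"
  unfolding convex_on_def
proof (intro conjI ballI allI impI)
  fix x y :: 'a and u v :: real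
  assume "0 \<le> u" "0 \<le> v" "u + v = 1"
  from convexD[OF assms[unfolded convex_fun_def] _ _ this, of "(x, \<phi> x)" "(y, \<phi> y)"]
  show "\<phi> (u *\<^sub>R x + v *\<^sub>R y) \<le> u * \<phi> x + v * \<phi> y"
    by (simp add: epi_def)
qed simp

theorem corollary3:
  fixes M :: "'w measure"
    and f g :: "'a::euclidean_space \<Rightarrow> ereal"
    and h1 :: "'b::euclidean_space \<Rightarrow> real"
    and \<K> :: "'c::euclidean_space set"
    and p1 :: "'a \<Rightarrow> 'b" and p2 :: "'a \<Rightarrow> 'c"
    and p :: "'a \<Rightarrow> 'b \<times> 'c" and h :: "'b \<times> 'c \<Rightarrow> ereal"
    and Lh1 :: real
    and \<epsilon> \<beta> :: "nat \<Rightarrow> real"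
    and xinit :: 'a and lam0 :: "'b \<times> 'c"
    and x :: "nat \<Rightarrow> 'w \<Rightarrow> 'a" and lam :: "nat \<Rightarrow> 'w \<Rightarrow> 'b \<times> 'c"
    and \<A> :: "'r \<Rightarrow> 'a \<Rightarrow> nat \<Rightarrow> ('a \<Rightarrow> ereal) \<Rightarrow> 'a"
    and \<xi> :: "nat \<Rightarrow> 'w \<Rightarrow> 'r"
    and K :: "nat \<Rightarrow> real"
    and H :: "nat \<Rightarrow> 'w \<Rightarrow> 'a \<Rightarrow> ereal"
    and s :: nat and m :: "'w \<Rightarrow> nat"
  assumes prob: "prob_space M"
    and g: "proper_fun g" "convex_fun g" "closed_fun g"
    and h1: "proper_fun (\<lambda>u. ereal (h1 u))" "convex_fun (\<lambda>u. ereal (h1 u))"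
            "closed_fun (\<lambda>u. ereal (h1 u))"
    and \<K>: "\<K> \<noteq> {}" "closed \<K>" "convex \<K>"
    and f: "\<And>z. f z \<noteq> -\<infinity>" "convex_fun f" "differentiable_near f (edom g)"
    and p1: "p1 differentiable_on UNIV" and p2: "p2 differentiable_on UNIV"
    and p_eq: "p = (\<lambda>z. (p1 z, p2 z))"
    and h_eq: "h = sep_sum h1 \<K>"
    and lipschitz: "Lh1-lipschitz_on UNIV h1"
    and b: "\<And>z y u v \<alpha>. 0 < \<alpha> \<Longrightarrow> \<alpha> < 1 \<Longrightarrow>
              h1 (p1 (\<alpha> *\<^sub>R z + (1 - \<alpha>) *\<^sub>R y) - \<alpha> *\<^sub>R u - (1 - \<alpha>) *\<^sub>R v)
                \<le> \<alpha> * h1 (p1 z - u) + (1 - \<alpha>) * h1 (p1 y - v)"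
    and c: "\<And>z y u v \<alpha>. 0 < \<alpha> \<Longrightarrow> \<alpha> < 1 \<Longrightarrow> p2 z - u \<in> \<K> \<Longrightarrow> p2 y - v \<in> \<K> \<Longrightarrow>
              p2 (\<alpha> *\<^sub>R z + (1 - \<alpha>) *\<^sub>R y) - \<alpha> *\<^sub>R u - (1 - \<alpha>) *\<^sub>R v \<in> \<K>"
    and d: "\<exists>xs ls. xs \<in> edom g \<and> ls \<in> edom (conjugate h) \<and> p2 xs \<in> \<K> \<and>
              (\<forall>z. primal_obj f g h p xs \<le> primal_obj f g h p z) \<and>
              (\<forall>l. dual_fun f g h p l \<le> dual_fun f g h p ls) \<and>
              f xs + g xs + ereal (h1 (p1 xs)) = lagrangian f g h p xs ls \<and>
              lagrangian f g h p xs ls = dual_fun f g h p ls"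
    and \<epsilon>_pos: "\<And>t. 0 < \<epsilon> t" and \<beta>_pos: "\<And>t. 0 < \<beta> t"
    and \<beta>_step: "\<And>t. \<beta> (Suc t) \<le> \<beta> t" "\<And>t. \<beta> t / 2 < \<beta> (Suc t)"
    and xinit: "xinit \<in> edom g" and lam0: "lam0 \<in> edom (conjugate h)"
    and x_random: "\<And>t. x t \<in> M \<rightarrow>\<^sub>M borel"
    and lam_0: "\<And>\<omega>. \<omega> \<in> space M \<Longrightarrow> lam 0 \<omega> = lam0"
    and lam_Suc: "\<And>t \<omega>. \<omega> \<in> space M \<Longrightarrow>
                    lam (Suc t) \<omega> = smooth_argmax h (p (x t \<omega>)) (lam t \<omega>) (\<beta> t)"
    and H_eq: "H = stage_obj f g h p \<beta> xinit x lam"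
    and K: "\<And>t. 1 \<le> K t"
    and solver: "\<And>t. lin_convergent M (history M x lam t) (edom g) (H t) \<A> (\<xi> t) (K t)"
    \<comment> \<open>the number of inner iterations may depend on everything known after stage s\<close>
    and m_meas: "m \<in> history M x lam (Suc s) \<rightarrow>\<^sub>M count_space UNIV"
    and m_pos: "AE \<omega> in M. 0 < m \<omega>"
    and m_large: "AE \<omega> in M.
          2 * \<epsilon> s
          + \<beta> s * (norm (lam (Suc s) \<omega> - lam s \<omega>))\<^sup>2
          + (\<beta> s - \<beta> (Suc s)) / 2 *
              (norm (smooth_argmax h (p (x s \<omega>)) (lam (Suc s) \<omega>) (\<beta> (Suc s)) - lam (Suc s) \<omega>))\<^sup>2
          + (\<beta> s)\<^sup>2 / (2 * \<beta> (Suc s) - \<beta> s) * (norm (prev_iterate xinit x s \<omega> - x s \<omega>))\<^sup>2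
          + norm (lam (Suc s) \<omega> - lam s \<omega>) *
              sqrt (((\<beta> s + \<beta> (Suc s)) * Lh1
                      + norm (\<beta> s *\<^sub>R fst (lam s \<omega>) - \<beta> (Suc s) *\<^sub>R fst (lam (Suc s) \<omega>)))\<^sup>2
                    + (norm (\<beta> s *\<^sub>R snd (lam s \<omega>) - \<beta> (Suc s) *\<^sub>R snd (lam (Suc s) \<omega>)))\<^sup>2)
          \<le> 2 powi \<lfloor>real (m \<omega>) / K (Suc s)\<rfloor> * \<epsilon> (Suc s) / 2"
    and x_Suc: "\<And>\<omega>. \<omega> \<in> space M \<Longrightarrow>
                  x (Suc s) \<omega> = \<A> (\<xi> (Suc s) \<omega>) (x s \<omega>) (m \<omega>) (H (Suc s) \<omega>)"
    and accuracy: "(\<integral>\<^sup>+ \<omega>. opt_gap (H s \<omega>) (x s \<omega>) \<partial>M) \<le> ennreal (\<epsilon> s)"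
  shows "(\<integral>\<^sup>+ \<omega>. opt_gap (H (Suc s) \<omega>) (x (Suc s) \<omega>) \<partial>M) \<le> ennreal (\<epsilon> (Suc s))"
proof -
  interpret prob_space M by fact
  define \<phi> where "\<phi> = (\<lambda>u :: 'b \<times> 'c. h1 (fst u))"
  define C where "C = (UNIV :: 'b set) \<times> \<K>"
  have h: "h u = (if u \<in> C then ereal (\<phi> u) else \<infinity>)" for u
    by (cases u) (auto simp: h_eq sep_sum_def set_indicator_def C_def \<phi>_def)
  have g_not: "g z \<noteq> -\<infinity>" for z using g(1) by (simp add: proper_fun_def)
  have f_fin: "\<bar>f z\<bar> \<noteq> \<infinity>" if "z \<in> edom g" for z
    using f(3) that unfolding differentiable_near_def by (metis subsetD)
  have sum_fin: "f z + g z \<noteq> \<infinity> \<longleftrightarrow> z \<in> edom g" for z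
    using f_fin[of z] by (auto simp: edom_def)
  interpret smoothed_composite \<phi> C Lh1 h f g p
  proof
    show "C \<noteq> {}" "closed C" using \<K> by (auto simp: C_def closed_Times)
    have "convex C" using \<K>(3) by (simp add: C_def convex_Times)
    thus "convex_on C \<phi>" using convex_on_of_convex_fun[OF h1(2)]
      by (auto simp: convex_on_def \<phi>_def)
    show "Lh1-lipschitz_on C \<phi>"
    proof (rule lipschitz_onI)
      show "0 \<le> Lh1" using lipschitz lipschitz_on_nonneg by blast
      fix u v :: "'b \<times> 'c"
      have "dist (\<phi> u) (\<phi> v) \<le> Lh1 * dist (fst u) (fst v)"
        unfolding \<phi>_def using lipschitz by (rule lipschitz_onD) auto
      also have "\<dots> \<le> Lh1 * dist u v"
        by (rule mult_left_mono[OF dist_fst_le \<open>0 \<le> Lh1\<close>])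
      finally show "dist (\<phi> u) (\<phi> v) \<le> Lh1 * dist u v" .
    qed
    show "h u = (if u \<in> C then ereal (\<phi> u) else \<infinity>)" for u by (rule h)
    show "f z + g z \<noteq> -\<infinity>" for z using f(1) g_not by simp
    show "\<exists>z. f z + g z \<noteq> \<infinity>" using sum_fin xinit by blast
    show "f (midpoint y z) + g (midpoint y z) \<le> ereal ((r + s) / 2)"
      if sums: "f y + g y = ereal r" "f z + g z = ereal s" for y z r s
    proof -
      obtain fy gy where y: "f y = ereal fy" "g y = ereal gy" "r = fy + gy"
        using sums(1) by (cases "f y"; cases "g y") auto
      obtain fz gz where z: "f z = ereal fz" "g z = ereal gz" "s = fz + gz"
        using sums(2) by (cases "f z"; cases "g z") auto
      have "f (midpoint y z) + g (midpoint y z) \<le> ereal ((fy + fz) / 2) + ereal ((gy + gz) / 2)"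
        using y z f(2) g(2) by (intro add_mono convex_fun_midpoint) auto
      thus ?thesis by (simp add: y z add_divide_distrib add_ac)
    qed
    show "p (midpoint y z) - midpoint (p y - t) (p z - r) \<in> C \<and>
        \<phi> (p (midpoint y z) - midpoint (p y - t) (p z - r)) \<le> (\<phi> t + \<phi> r) / 2"
      if "t \<in> C" "r \<in> C" for y z t r
      using b[of "1/2" y z "p1 y - fst t" "p1 z - fst r"]
        c[of "1/2" y "p2 y - snd t" z "p2 z - snd r"] that
      by (auto simp: p_eq \<phi>_def C_def midpoint_def scaleR_add_right diff_diff_eq
          scaleR_diff_right)
  qed
  have [measurable]: "p \<in> borel_measurable borel"
    unfolding p_eq
    by (intro borel_measurable_continuous_onI continuous_on_Pair differentiable_imp_continuous_on p1 p2)
  have g_borel: "g \<in> borel_measurable borel" by (rule borel_measurable_closed_fun[OF g(3,1)])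
  have sum_borel: "(\<lambda>z. f z + g z) \<in> borel_measurable borel"
    by (rule borel_measurable_sum_differentiable_near[OF g_borel f(1,3)])
  have lam_random: "lam t \<in> borel_measurable M" for t
  proof (induction t)
    case 0
    show ?case using lam_0 by (subst measurable_cong[where g = "\<lambda>_. lam0"]) auto
  next
    case (Suc t)
    have [measurable]: "(\<lambda>\<omega>. p (x t \<omega>)) \<in> borel_measurable M"
      by (rule measurable_compose[OF x_random]) measurable
    show ?case
      by (subst measurable_cong[OF lam_Suc], assumption)
        (rule borel_measurable_smooth_argmax[OF \<beta>_pos _ Suc], measurable)
  qed
  have prev_random: "prev_iterate xinit x t \<in> borel_measurable M" for t
    using x_random by (cases t) (simp_all add: prev_iterate_def[abs_def])
  have gap_borel: "(\<lambda>\<omega>. opt_gap (H t \<omega>) (y \<omega>)) \<in> borel_measurable M"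
    if "y \<in> borel_measurable M" for t y
    using borel_measurable_opt_gap[OF \<beta>_pos sum_borel _ that prev_random lam_random, of t t t]
    by (simp add: H_eq stage_obj_def[abs_def])

  \<comment> \<open>a finite expected gap makes the iterate almost surely feasible, as the solver needs\<close>
  have "AE \<omega> in M. opt_gap (H s \<omega>) (x s \<omega>) \<noteq> \<infinity>"
    using accuracy by (intro nn_integral_PInf_AE gap_borel x_random) (auto simp: top_unique)
  hence x_dom: "AE \<omega> in M. x s \<omega> \<in> edom g"
  proof eventually_elim
    case (elim \<omega>)
    show ?case
      using opt_gap_finite_imp[OF \<beta>_pos, where y = "prev_iterate xinit x s \<omega>" and l = "lam s \<omega>"] elim
      unfolding sum_fin by (simp add: H_eq stage_obj_def[abs_def])
  qed

  define D where "D = (\<lambda>\<omega>. \<beta> s * (norm (lam (Suc s) \<omega> - lam s \<omega>))\<^sup>2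
    + (\<beta> s - \<beta> (Suc s)) / 2 *
        (norm (smooth_argmax h (p (x s \<omega>)) (lam (Suc s) \<omega>) (\<beta> (Suc s)) - lam (Suc s) \<omega>))\<^sup>2
    + (\<beta> s)\<^sup>2 / (2 * \<beta> (Suc s) - \<beta> s) * (norm (prev_iterate xinit x s \<omega> - x s \<omega>))\<^sup>2)"
  define q where "q = (\<lambda>\<omega>. (2::real) powi (- \<lfloor>real (m \<omega>) / K (Suc s)\<rfloor>))"
  have D_nonneg: "0 \<le> D \<omega>" for \<omega>
    unfolding D_def using \<beta>_pos[of s] \<beta>_step[of s] by (intro add_nonneg_nonneg) auto
  have qD: "AE \<omega> in M. q \<omega> * (2 * \<epsilon> s + D \<omega>) \<le> \<epsilon> (Suc s) / 2"
    using m_large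
  proof eventually_elim
    case (elim \<omega>)
    define T where "T = (2::real) powi \<lfloor>real (m \<omega>) / K (Suc s)\<rfloor>"
    have "2 * \<epsilon> s + D \<omega> \<le> T * \<epsilon> (Suc s) / 2"
      unfolding D_def T_def by (rule order_trans[OF _ elim]) simp
    hence "q \<omega> * (2 * \<epsilon> s + D \<omega>) \<le> q \<omega> * (T * \<epsilon> (Suc s) / 2)"
      by (rule mult_left_mono) (simp add: q_def)
    moreover have "q \<omega> * T = 1" by (simp add: q_def T_def power_int_minus)
    hence "q \<omega> * (T * \<epsilon> (Suc s) / 2) = \<epsilon> (Suc s) / 2"
      by (metis mult.assoc mult_1 times_divide_eq_right)
    ultimately show ?case by (simp only:)
  qed
  have gap_step: "AE \<omega> in M. opt_gap (H (Suc s) \<omega>) (x s \<omega>) \<le> 2 * opt_gap (H s \<omega>) (x s \<omega>) + ennreal (D \<omega>)"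
  proof (rule AE_I2)
    fix \<omega> assume \<omega>: "\<omega> \<in> space M"
    show "opt_gap (H (Suc s) \<omega>) (x s \<omega>) \<le> 2 * opt_gap (H s \<omega>) (x s \<omega>) + ennreal (D \<omega>)"
      using opt_gap_next_stage_le[OF \<beta>_pos \<beta>_pos \<beta>_step, of "x s \<omega>" "lam s \<omega>" s "prev_iterate xinit x s \<omega>"]
        \<beta>_step[of s]
      by (simp add: H_eq stage_obj_def[abs_def] D_def lam_Suc[OF \<omega>] prev_iterate_def[of _ _ "Suc s"])
  qed
  have "(\<integral>\<^sup>+ \<omega>. opt_gap (H (Suc s) \<omega>) (x (Suc s) \<omega>) \<partial>M)
      = (\<integral>\<^sup>+ \<omega>. opt_gap (H (Suc s) \<omega>) (\<A> (\<xi> (Suc s) \<omega>) (x s \<omega>) (m \<omega>) (H (Suc s) \<omega>)) \<partial>M)"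
    by (rule nn_integral_cong) (simp add: x_Suc)
  also have "\<dots> \<le> (\<integral>\<^sup>+ \<omega>. ennreal (q \<omega>) * opt_gap (H (Suc s) \<omega>) (x s \<omega>) \<partial>M)"
    unfolding q_def
  proof (rule nn_integral_opt_gap_solver_le[OF prob subalgebra_history[OF x_random lam_random] solver])
    show "edom g \<in> sets borel" using g_borel unfolding edom_def by measurable
  qed (use xinit measurable_history[OF lessI] x_dom m_meas gap_borel in auto)
  also have "\<dots> \<le> ennreal (\<epsilon> (Suc s))"
    by (rule discounted_nn_integral_le[OF prob \<epsilon>_pos \<epsilon>_pos gap_borel[OF x_random] accuracy _ D_nonneg qD gap_step])
      (simp add: q_def)
  finally show ?thesis .
qed

end
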